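(* Suppose $\mu=0$ (i.e. $\psi$ is only assumed convex) and the iterates $\boldsymbol{x}_1,\dots,\boldsymbol{x}_{T+1}$ are produced by the General Proximal Gradient Method under the Single Shuffle ($\mathsf{SS}$) sampling scheme, for arbitrary $T\in\mathbb{N}$, with stepsizes $\eta_t=\frac{\eta}{\sqrt{T}}$ for all $t\in[T]$, where $\eta>0$. Then for any $\boldsymbol{z}\in\mathbb{R}^d$, $$\mathbb{E}[F(\boldsymbol{x}_{T+1})-F(\boldsymbol{z})]\le O\left(\left(\frac{\|\boldsymbol{z}-\boldsymbol{x}_1\|^2}{\eta}+\eta\left(\mathsf{q}(T)G_{f,2}^2\lor\sqrt{n\,\mathsf{q}(T)}\,G_{f,1}G_{f,2}\right)(1+\log T)\right)\frac{1}{\sqrt{T}}\right).$$ Set $\eta=\frac{\|\boldsymbol{z}-\boldsymbol{x}_1\|}{\sqrt{\left(\mathsf{q}(T)G_{f,2}^2\lor\sqrt{n\,\mathsf{q}(T)}\,G_{f,1}G_{f,2}\right)(1+\log T)}}$ to optimize the dependence on parameters.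
   Context: Notation: $\mathbb{N}=\{1,2,\dots\}$, $[m]=\{1,\dots,m\}$, $a\lor b=\max\{a,b\}$, $\|\cdot\|$ and $\langle\cdot,\cdot\rangle$ are the Euclidean norm and inner product on $\mathbb{R}^d$, $\overline{\mathbb{R}}=(-\infty,+\infty]$, $\mathrm{dom}\,h=\{\boldsymbol{x}:h(\boldsymbol{x})<+\infty\}$, $\partial h(\boldsymbol{x})$ is the convex subdifferential and $\nabla h(\boldsymbol{x})$ denotes an element of $\partial h(\boldsymbol{x})$. $O(\cdot)$ hides an absolute constant. Problem: $F=f+\psi$ with $f=\frac1n\sum_{i=1}^n f_i$, each $f_i:\mathbb{R}^d\to\mathbb{R}$ convex, and $\psi:\mathbb{R}^d\to\overline{\mathbb{R}}$ proper, closed and convex. Each $f_i$ is $G_i$-Lipschitz on $\mathrm{dom}\,\psi$ for some $G_i>0$. For every $i\in[n]$ and $\boldsymbol{x}\in\mathbb{R}^d$, $\nabla f_i(\boldsymbol{x})$ is deterministically picked from $\partial f_i(\boldsymbol{x})$. Put $G_{f,1}=\frac1n\sum_{i=1}^nG_i$ and $G_{f,2}=\sqrt{\frac1n\sum_{i=1}^nG_i^2}$. General Proximal Gradient Method: given an initial point $\boldsymbol{x}_1\in\mathrm{dom}\,\psi$ and stepsizes $\eta_t>0$, $t\in[T]$, for $t=1,\dots,T$ generate an index $\mathsf{i}(t)\in[n]$ and set $$\boldsymbol{x}_{t+1}=\mathrm{argmin}_{\boldsymbol{x}\in\mathbb{R}^d}\ \psi(\boldsymbol{x})+\langle\nabla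 f_{\mathsf{i}(t)}(\boldsymbol{x}_t),\boldsymbol{x}\rangle+\frac{\|\boldsymbol{x}-\boldsymbol{x}_t\|^2}{2\eta_t}.$$ For $t\in\mathbb{N}$, $\mathsf{q}(t)=\lceil t/n\rceil$ and $\mathsf{r}(t)=t-(\mathsf{q}(t)-1)n\in[n]$. $\mathsf{SS}$ sampling scheme: $\mathsf{i}(t)=\pi^{\mathsf{r}(t)}$ where $\pi=(\pi^1,\dots,\pi^n)$ is a single uniformly random permutation of $[n]$.
   Formalization: Besides each f_i being G_i-Lipschitz on dom ψ, the formal statement assumes that the picked subgradients satisfy ‖∇f_i(x)‖ ≤ G_i for x in dom ψ; without this the bound fails when a large subgradient is picked at a boundary point of dom ψ. *)

theory Defs
  imports "HOL-Probability.Probability" "HOL-Combinatorics.Permutations"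
begin

section \<open>The spaces \<open>R\<^sup>d\<close> with \<open>d\<close> a term\<close>

text \<open>The constant hidden in a bound \<open>O(...)\<close> must not depend on the dimension, so
  \<open>\<exists>C\<close> has to precede \<open>\<forall>d\<close> inside one formula and \<open>d\<close> cannot be encoded in a type.
  All the spaces \<open>R\<^sup>d\<close> are therefore taken inside the inner product space of finitely
  supported real sequences, as the subspaces of sequences vanishing from index \<open>d\<close> on.\<close>

typedef fin_seq = "{x :: nat \<Rightarrow> real. finite {i. x i \<noteq> 0}}"
  morphisms coord Abs_fin_seq
  by (rule exI[of _ "\<lambda>_. 0"]) simp

setup_lifting type_definition_fin_seq

lemma finite_supp: "finite {i. coord x i \<noteq> 0}"
  using coord by auto

lemma fin_seq_eqI: "(\<And>i. coord x i = coord y i) \<Longrightarrow> x = y"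
  by (rule coord_inject[THEN iffD1], rule ext)

instantiation fin_seq :: real_vector
begin

lift_definition zero_fin_seq :: fin_seq is "\<lambda>_. 0" by simp

lift_definition plus_fin_seq :: "fin_seq \<Rightarrow> fin_seq \<Rightarrow> fin_seq" is "\<lambda>x y i. x i + y i"
  subgoal for x y
    by (rule finite_subset[of _ "{i. x i \<noteq> 0} \<union> {i. y i \<noteq> 0}"]) auto
  done

lift_definition minus_fin_seq :: "fin_seq \<Rightarrow> fin_seq \<Rightarrow> fin_seq" is "\<lambda>x y i. x i - y i"
  subgoal for x y
    by (rule finite_subset[of _ "{i. x i \<noteq> 0} \<union> {i. y i \<noteq> 0}"]) auto
  done

lift_definition uminus_fin_seq :: "fin_seq \<Rightarrow> fin_seq" is "\<lambda>x i. - x i" by simp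

lift_definition scaleR_fin_seq :: "real \<Rightarrow> fin_seq \<Rightarrow> fin_seq" is "\<lambda>c x i. c * x i"
  subgoal for c x
    by (rule finite_subset[of _ "{i. x i \<noteq> 0}"]) auto
  done

instance
  by standard (transfer; auto simp: algebra_simps)+

end

lemmas coord_simps [simp] =
  zero_fin_seq.rep_eq plus_fin_seq.rep_eq minus_fin_seq.rep_eq
  uminus_fin_seq.rep_eq scaleR_fin_seq.rep_eq

instantiation fin_seq :: real_inner
begin

definition inner_fin_seq :: "fin_seq \<Rightarrow> fin_seq \<Rightarrow> real" where
  "inner_fin_seq x y = (\<Sum>i | coord x i \<noteq> 0. coord x i * coord y i)"

definition norm_fin_seq :: "fin_seq \<Rightarrow> real" where
  "norm_fin_seq x = sqrt (inner x x)"

definition sgn_fin_seq :: "fin_seq \<Rightarrow> fin_seq" where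
  "sgn_fin_seq x = x /\<^sub>R norm x"

definition dist_fin_seq :: "fin_seq \<Rightarrow> fin_seq \<Rightarrow> real" where
  "dist_fin_seq x y = norm (x - y)"

definition uniformity_fin_seq :: "(fin_seq \<times> fin_seq) filter" where
  "uniformity_fin_seq = (INF e\<in>{0<..}. principal {(x, y). dist x y < e})"

definition open_fin_seq :: "fin_seq set \<Rightarrow> bool" where
  "open_fin_seq U \<longleftrightarrow> (\<forall>x\<in>U. \<forall>\<^sub>F (x', y) in uniformity. x' = x \<longrightarrow> y \<in> U)"

lemma inner_fin_seq_superset:
  assumes "finite A" "\<And>i. i \<notin> A \<Longrightarrow> coord x i = 0"
  shows "inner x y = (\<Sum>i\<in>A. coord x i * coord y i)"
  unfolding inner_fin_seq_def
  by (rule sum.mono_neutral_left) (use assms in auto)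

instance
proof
  fix x y z :: fin_seq and r :: real
  let ?A = "{i. coord x i \<noteq> 0} \<union> {i. coord y i \<noteq> 0}"
  have fin: "finite ?A" by (simp add: finite_supp)
  have x: "inner x w = (\<Sum>i\<in>?A. coord x i * coord w i)" for w
    by (rule inner_fin_seq_superset[OF fin]) auto
  have y: "inner y w = (\<Sum>i\<in>?A. coord y i * coord w i)" for w
    by (rule inner_fin_seq_superset[OF fin]) auto
  have xy: "inner (x + y) w = (\<Sum>i\<in>?A. coord (x + y) i * coord w i)" for w
    by (rule inner_fin_seq_superset[OF fin]) auto
  have rx: "inner (r *\<^sub>R x) w = (\<Sum>i\<in>?A. coord (r *\<^sub>R x) i * coord w i)" for w
    by (rule inner_fin_seq_superset[OF fin]) auto
  show "inner x y = inner y x"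
    unfolding x y by (simp add: mult.commute)
  show "inner (x + y) z = inner x z + inner y z"
    unfolding x y xy by (simp add: sum.distrib algebra_simps)
  show "inner (r *\<^sub>R x) y = r * inner x y"
    unfolding x rx by (simp add: sum_distrib_left algebra_simps)
  show "0 \<le> inner x x"
    unfolding inner_fin_seq_def by (rule sum_nonneg) simp
  show "inner x x = 0 \<longleftrightarrow> x = 0"
  proof
    assume "inner x x = 0"
    then have "\<forall>i\<in>{i. coord x i \<noteq> 0}. coord x i * coord x i = 0"
      unfolding inner_fin_seq_def by (subst (asm) sum_nonneg_eq_0_iff) (auto simp: finite_supp)
    then show "x = 0" by (intro fin_seq_eqI) auto
  qed (simp add: inner_fin_seq_def)
qed (simp_all add: norm_fin_seq_def sgn_fin_seq_def dist_fin_seq_def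
       uniformity_fin_seq_def open_fin_seq_def)

end

definition Rd :: "nat \<Rightarrow> fin_seq set" where
  "Rd d = {x. \<forall>i\<ge>d. coord x i = 0}"

lemma subspace_Rd: "subspace (Rd d)"
  by (auto simp: subspace_def Rd_def)

lemma bij_betw_coord_Rd:
  "bij_betw coord (Rd d) {a :: nat \<Rightarrow> real. \<forall>i\<ge>d. a i = 0}"
proof (rule bij_betw_imageI)
  show "inj_on coord (Rd d)" by (simp add: inj_on_def coord_inject)
  show "coord ` Rd d = {a. \<forall>i\<ge>d. a i = 0}"
  proof (intro subset_antisym subsetI)
    fix a :: "nat \<Rightarrow> real" assume a: "a \<in> {a. \<forall>i\<ge>d. a i = 0}"
    then have "{i. a i \<noteq> 0} \<subseteq> {..<d}"
      using linorder_not_le by blast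
    then have "finite {i. a i \<noteq> 0}"
      by (rule finite_subset) simp
    then have "coord (Abs_fin_seq a) = a" by (simp add: Abs_fin_seq_inverse)
    with a show "a \<in> coord ` Rd d"
      by (intro image_eqI[of _ _ "Abs_fin_seq a"]) (auto simp: Rd_def)
  qed (auto simp: Rd_def)
qed

lemma inner_Rd: "x \<in> Rd d \<Longrightarrow> inner x y = (\<Sum>i<d. coord x i * coord y i)"
  by (rule inner_fin_seq_superset) (auto simp: Rd_def)

lemma norm_Rd: "x \<in> Rd d \<Longrightarrow> norm x = sqrt (\<Sum>i<d. (coord x i)\<^sup>2)"
  by (simp add: norm_eq_sqrt_inner inner_Rd power2_eq_square)


section \<open>Extended real valued convex functions and subgradients\<close>

text \<open>In this section \<open>S\<close> is the ambient space; functions are only looked at on \<open>S\<close>.\<close>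

definition edom :: "'a set \<Rightarrow> ('a \<Rightarrow> ereal) \<Rightarrow> 'a set" where
  "edom S h = {x \<in> S. h x < \<infinity>}"

definition eepigraph :: "'a set \<Rightarrow> ('a \<Rightarrow> ereal) \<Rightarrow> ('a \<times> real) set" where
  "eepigraph S h = {(x, r). x \<in> S \<and> h x \<le> ereal r}"

definition proper_closed_convex :: "'a::real_normed_vector set \<Rightarrow> ('a \<Rightarrow> ereal) \<Rightarrow> bool" where
  "proper_closed_convex S h \<longleftrightarrow>
     (\<forall>x\<in>S. h x \<noteq> -\<infinity>) \<and> edom S h \<noteq> {} \<and>
     closedin (top_of_set (S \<times> UNIV)) (eepigraph S h) \<and>
     convex (eepigraph S h)"

definition subdifferential :: "'a::real_inner set \<Rightarrow> ('a \<Rightarrow> real) \<Rightarrow> 'a \<Rightarrow> 'a set" where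
  "subdifferential S h x = {g \<in> S. \<forall>y\<in>S. h x + inner g (y - x) \<le> h y}"


section \<open>The composite problem\<close>

text \<open>\<open>g i x\<close> is the selected subgradient of \<open>f i\<close> at \<open>x\<close>. That \<open>f i\<close> is
  \<open>G i\<close>-Lipschitz on the domain of \<open>\<psi>\<close> is meant to include that the selected subgradients at
  points of the domain are bounded by \<open>G i\<close>. At interior points of the domain this follows from
  the Lipschitz inequality; at boundary points it does not, and there the convergence of the
  method would fail without it. For example, on the real line let \<open>n = T = 1\<close>,
  \<open>\<psi> = 0\<close> on \<open>x \<ge> 0\<close>, \<open>\<psi> = \<infinity>\<close> elsewhere, \<open>x\<^sub>1 = z = 0\<close>,
  \<open>f x = G * x + M * max 0 (-x)\<close>, with selected subgradient \<open>G - M\<close> at \<open>0\<close> and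
  \<open>M\<close> much larger than \<open>G\<close>: the single step moves to \<open>\<eta> * (M - G)\<close>.\<close>

definition composite_problem ::
  "nat \<Rightarrow> nat \<Rightarrow> (nat \<Rightarrow> fin_seq \<Rightarrow> real) \<Rightarrow> (nat \<Rightarrow> fin_seq \<Rightarrow> fin_seq) \<Rightarrow>
   (fin_seq \<Rightarrow> ereal) \<Rightarrow> (nat \<Rightarrow> real) \<Rightarrow> bool" where
  "composite_problem d n f g \<psi> G \<longleftrightarrow>
     d \<ge> 1 \<and> n \<ge> 1 \<and>
     proper_closed_convex (Rd d) \<psi> \<and>
     (\<forall>i\<in>{1..n}.
        convex_on (Rd d) (f i) \<and>
        (\<forall>x\<in>Rd d. g i x \<in> subdifferential (Rd d) (f i) x) \<and>
        G i > 0 \<and>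
        (G i)-lipschitz_on (edom (Rd d) \<psi>) (f i) \<and>
        (\<forall>x\<in>edom (Rd d) \<psi>. norm (g i x) \<le> G i))"

definition objective ::
  "nat \<Rightarrow> (nat \<Rightarrow> fin_seq \<Rightarrow> real) \<Rightarrow> (fin_seq \<Rightarrow> ereal) \<Rightarrow> fin_seq \<Rightarrow> ereal" where
  "objective n f \<psi> x = ereal ((\<Sum>i=1..n. f i x) / real n) + \<psi> x"

definition Gf1 :: "nat \<Rightarrow> (nat \<Rightarrow> real) \<Rightarrow> real" where
  "Gf1 n G = (\<Sum>i=1..n. G i) / real n"

definition Gf2 :: "nat \<Rightarrow> (nat \<Rightarrow> real) \<Rightarrow> real" where
  "Gf2 n G = sqrt ((\<Sum>i=1..n. (G i)\<^sup>2) / real n)"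


section \<open>The proximal gradient method with a single shuffle\<close>

definition prox_gradient_iterates ::
  "nat \<Rightarrow> (nat \<Rightarrow> fin_seq \<Rightarrow> fin_seq) \<Rightarrow> (fin_seq \<Rightarrow> ereal) \<Rightarrow> fin_seq \<Rightarrow>
   nat \<Rightarrow> (nat \<Rightarrow> real) \<Rightarrow> (nat \<Rightarrow> nat) \<Rightarrow> (nat \<Rightarrow> fin_seq) \<Rightarrow> bool" where
  "prox_gradient_iterates d g \<psi> x1 T \<eta> idx x \<longleftrightarrow>
     x 1 = x1 \<and>
     (\<forall>t\<in>{1..T}. is_arg_min
        (\<lambda>y. \<psi> y + ereal (inner (g (idx t) (x t)) y + (norm (y - x t))\<^sup>2 / (2 * \<eta> t)))
        (\<lambda>y. y \<in> Rd d) (x (t + 1)))"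

definition q_epoch :: "nat \<Rightarrow> nat \<Rightarrow> nat" where
  "q_epoch n t = nat \<lceil>real t / real n\<rceil>"

definition r_epoch :: "nat \<Rightarrow> nat \<Rightarrow> nat" where
  "r_epoch n t = t - (q_epoch n t - 1) * n"

definition ss_index :: "nat \<Rightarrow> (nat \<Rightarrow> nat) \<Rightarrow> nat \<Rightarrow> nat" where
  "ss_index n p t = p (r_epoch n t)"

definition uniform_permutation :: "nat \<Rightarrow> (nat \<Rightarrow> nat) pmf" where
  "uniform_permutation n = pmf_of_set {p. p permutes {1..n}}"

text \<open>Expectation of an extended real random variable as \<open>E[X\<^sup>+] - E[X\<^sup>-]\<close>, since
  the Bochner integral does not apply to type \<^typ>\<open>ereal\<close>. The convention
  \<open>\<infinity> - \<infinity> = \<infinity>\<close> of that type only makes an upper bound harder to satisfy.\<close>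

definition ereal_expectation :: "'a pmf \<Rightarrow> ('a \<Rightarrow> ereal) \<Rightarrow> ereal" where
  "ereal_expectation M X =
     enn2ereal (\<integral>\<^sup>+ \<omega>. e2ennreal (X \<omega>) \<partial>measure_pmf M) -
     enn2ereal (\<integral>\<^sup>+ \<omega>. e2ennreal (- X \<omega>) \<partial>measure_pmf M)"

definition ss_noise :: "nat \<Rightarrow> nat \<Rightarrow> (nat \<Rightarrow> real) \<Rightarrow> real" where
  "ss_noise n T G =
     max (real (q_epoch n T) * (Gf2 n G)\<^sup>2)
         (sqrt (real n * real (q_epoch n T)) * Gf1 n G * Gf2 n G) * (1 + ln (real T))"

definition ss_rate ::
  "nat \<Rightarrow> nat \<Rightarrow> (nat \<Rightarrow> real) \<Rightarrow> fin_seq \<Rightarrow> fin_seq \<Rightarrow> real \<Rightarrow> real" where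
  "ss_rate n T G x1 z \<eta> =
     ((norm (z - x1))\<^sup>2 / \<eta> + \<eta> * ss_noise n T G) * (1 / sqrt (real T))"

end

theory Submission
  imports Defs
begin

text \<open>
  If the index used at step \<open>t\<close> were independent of the current iterate and of every earlier one,
  the standard one-step inequality of the proximal gradient method, taken in expectation with a
  reference point \<open>w\<close>, would control \<open>E[F(x\<^bsub>t+1\<^esub>) - F(w)]\<close> both for \<open>w = z\<close> and for \<open>w = x\<^sub>s\<close>
  with \<open>s \<le> t\<close>. With a single shuffle the two are dependent, and the whole difficulty is to bound
  the selection bias \<open>E[f\<^bsub>\<pi>(a)\<^esub>(x\<^sub>t) - f(x\<^sub>t)]\<close> for a fixed position \<open>a\<close> (lemma
  \<open>selection_bias\<close>).

  Since \<open>f\<close> is the average of the \<open>f\<^bsub>\<pi>(b)\<^esub>\<close> over all positions \<open>b\<close>, it suffices to compare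
  \<open>f\<^bsub>\<pi>(a)\<^esub>(x\<^sub>t)\<close> with \<open>f\<^bsub>\<pi>(b)\<^esub>(x\<^sub>t)\<close> in mean. Swapping the entries \<open>a\<close> and \<open>b\<close> of \<open>\<pi>\<close> preserves the
  uniform distribution and turns the first quantity into the second one, except that the iterate is
  now the one produced by the swapped permutation. By Lipschitz continuity the bias is therefore at
  most the mean of \<open>G\<^bsub>\<pi>(b)\<^esub>\<close> times the distance between the two runs. This is an argument of
  algorithmic stability. The two runs use the same component function except at most twice per
  epoch. A common function increases the squared distance by at most \<open>4 h\<^sup>2 G\<^sup>2\<close>, where \<open>h\<close> is the
  stepsize, because proximal maps are nonexpansive and subdifferentials are monotone; a step with
  different functions increases the distance by at most \<open>h (G\<^bsub>\<pi>(a)\<^esub> + G\<^bsub>\<pi>(b)\<^esub>)\<close>. Over \<open>q\<close> epochs this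
  gives a distance of order \<open>h (\<surd>(n q) G\<^bsub>f,2\<^esub> + q (G\<^bsub>\<pi>(a)\<^esub> + G\<^bsub>\<pi>(b)\<^esub>))\<close> (lemma \<open>iterates_stable\<close>),
  and multiplication by \<open>G\<^bsub>\<pi>(b)\<^esub>\<close> and averaging produce the two terms of the maximum in the rate.

  It follows that the expected suboptimality along every suffix \<open>s, ..., T\<close> exceeds that of \<open>x\<^sub>s\<close> by
  at most a constant \<open>B\<close> per step. Such a control of all suffixes makes the last value at most the
  average of all values plus \<open>B ln T\<close> (lemma \<open>last_iterate_le_average\<close>), which is where the logarithm
  comes from. The average itself is bounded by telescoping with \<open>w = z\<close>.
\<close>

section \<open>Proximal steps\<close>

lemma edom_realE:
  assumes "proper_closed_convex S \<psi>" "y \<in> edom S \<psi>"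
  shows "\<psi> y = ereal (real_of_ereal (\<psi> y))"
  using assms by (auto simp: proper_closed_convex_def edom_def ereal_real)

lemma edom_convex_comb:
  assumes pcc: "proper_closed_convex S \<psi>"
    and u: "u \<in> edom S \<psi>" and v: "v \<in> edom S \<psi>" and l: "0 \<le> l" "l \<le> 1"
  shows "(1 - l) *\<^sub>R u + l *\<^sub>R v \<in> S"
    and "\<psi> ((1 - l) *\<^sub>R u + l *\<^sub>R v)
           \<le> ereal ((1 - l) * real_of_ereal (\<psi> u) + l * real_of_ereal (\<psi> v))"
proof -
  have in_epi: "(w, real_of_ereal (\<psi> w)) \<in> eepigraph S \<psi>" if "w \<in> edom S \<psi>" for w
    using edom_realE[OF pcc that] that by (auto simp: eepigraph_def edom_def)
  have "convex (eepigraph S \<psi>)"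
    using pcc by (simp add: proper_closed_convex_def)
  then have "(1 - l) *\<^sub>R (u, real_of_ereal (\<psi> u)) + l *\<^sub>R (v, real_of_ereal (\<psi> v)) \<in> eepigraph S \<psi>"
    using in_epi[OF u] in_epi[OF v] l by (intro convexD) auto
  then show "(1 - l) *\<^sub>R u + l *\<^sub>R v \<in> S"
    and "\<psi> ((1 - l) *\<^sub>R u + l *\<^sub>R v)
           \<le> ereal ((1 - l) * real_of_ereal (\<psi> u) + l * real_of_ereal (\<psi> v))"
    by (auto simp: eepigraph_def)
qed

lemma norm_sq_convex_comb:
  fixes a b :: "'a::real_inner"
  shows "(norm ((1 - l) *\<^sub>R a + l *\<^sub>R b))\<^sup>2
           = (1 - l) * (norm a)\<^sup>2 + l * (norm b)\<^sup>2 - l * (1 - l) * (norm (b - a))\<^sup>2"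
  unfolding power2_norm_eq_inner
  by (simp add: inner_add_left inner_add_right inner_diff_left inner_diff_right
      inner_commute algebra_simps)

definition prox_step :: "'a::real_inner set \<Rightarrow> ('a \<Rightarrow> ereal) \<Rightarrow> real \<Rightarrow> 'a \<Rightarrow> 'a \<Rightarrow> 'a \<Rightarrow> bool" where
  "prox_step S \<psi> h v x x' \<longleftrightarrow>
     is_arg_min (\<lambda>y. \<psi> y + ereal (inner v y + (norm (y - x))\<^sup>2 / (2 * h))) (\<lambda>y. y \<in> S) x'"

lemma prox_step_edom:
  assumes pcc: "proper_closed_convex S \<psi>" and step: "prox_step S \<psi> h v x x'"
  shows "x' \<in> edom S \<psi>"
proof -
  obtain y where y: "y \<in> S" "\<psi> y < \<infinity>"
    using pcc by (auto simp: proper_closed_convex_def edom_def)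
  have x': "x' \<in> S"
    and le: "\<psi> x' + ereal (inner v x' + (norm (x' - x))\<^sup>2 / (2 * h))
          \<le> \<psi> y + ereal (inner v y + (norm (y - x))\<^sup>2 / (2 * h))"
    using step y(1) by (auto simp: prox_step_def is_arg_min_linorder)
  then have "\<psi> x' < \<infinity>"
    using y(2) by (cases "\<psi> x'"; cases "\<psi> y") auto
  with x' show ?thesis by (simp add: edom_def)
qed

text \<open>The objective minimized by the step is \<open>1/h\<close>-strongly convex, so it grows quadratically away
  from its minimizer. As \<open>\<psi>\<close> is only convex, and not differentiable, the minimizer is compared with
  points of the segment towards \<open>y\<close>, and the other end of the segment tends to the minimizer.\<close>

lemma prox_step_three_point:
  assumes pcc: "proper_closed_convex S \<psi>" and step: "prox_step S \<psi> h v x x'"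
    and h: "h > 0" and y: "y \<in> edom S \<psi>"
  shows "real_of_ereal (\<psi> x') + inner v x' + (norm (x' - x))\<^sup>2 / (2 * h) + (norm (y - x'))\<^sup>2 / (2 * h)
           \<le> real_of_ereal (\<psi> y) + inner v y + (norm (y - x))\<^sup>2 / (2 * h)"
proof -
  have x': "x' \<in> edom S \<psi>" by (rule prox_step_edom[OF pcc step])
  define P where "P w = real_of_ereal (\<psi> w)" for w
  define A where "A = P x' + inner v x' + (norm (x' - x))\<^sup>2 / (2 * h)"
  define B where "B = P y + inner v y + (norm (y - x))\<^sup>2 / (2 * h)"
  define D where "D = (norm (y - x'))\<^sup>2 / (2 * h)"
  \<comment> \<open>minimality of \<open>x'\<close> against the point of the segment with weight \<open>l\<close>, divided by \<open>l\<close>\<close>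
  have key: "A + (1 - l) * D \<le> B" if l: "0 < l" "l < 1" for l
  proof -
    define w where "w = (1 - l) *\<^sub>R x' + l *\<^sub>R y"
    have wS: "w \<in> S" and Pw: "\<psi> w \<le> ereal ((1 - l) * P x' + l * P y)"
      using edom_convex_comb[OF pcc x' y, of l] l by (auto simp: w_def P_def)
    have "ereal A = \<psi> x' + ereal (inner v x' + (norm (x' - x))\<^sup>2 / (2 * h))"
      unfolding A_def P_def by (subst edom_realE[OF pcc x']) (simp add: add.assoc)
    also have "\<dots> \<le> \<psi> w + ereal (inner v w + (norm (w - x))\<^sup>2 / (2 * h))"
      using step wS by (auto simp: prox_step_def is_arg_min_linorder)
    also have "\<dots> \<le> ereal ((1 - l) * P x' + l * P y) + ereal (inner v w + (norm (w - x))\<^sup>2 / (2 * h))"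
      using Pw by (intro add_right_mono)
    finally have le: "A \<le> (1 - l) * P x' + l * P y + inner v w + (norm (w - x))\<^sup>2 / (2 * h)"
      by (simp add: add.assoc)
    have "w - x = (1 - l) *\<^sub>R (x' - x) + l *\<^sub>R (y - x)"
      by (simp add: w_def algebra_simps)
    then have "(norm (w - x))\<^sup>2 = (1 - l) * (norm (x' - x))\<^sup>2 + l * (norm (y - x))\<^sup>2
        - l * (1 - l) * (norm (y - x'))\<^sup>2"
      by (simp add: norm_sq_convex_comb)
    then have "(norm (w - x))\<^sup>2 / (2 * h) = (1 - l) * ((norm (x' - x))\<^sup>2 / (2 * h))
        + l * ((norm (y - x))\<^sup>2 / (2 * h)) - l * (1 - l) * D"
      by (simp add: D_def add_divide_distrib diff_divide_distrib)
    moreover have "inner v w = (1 - l) * inner v x' + l * inner v y"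
      by (simp add: w_def inner_add_right)
    ultimately have "A \<le> (1 - l) * A + l * B - l * (1 - l) * D"
      using le by (simp add: A_def B_def algebra_simps)
    then have "l * (A + (1 - l) * D) \<le> l * B" by (simp add: algebra_simps)
    then show ?thesis using l by simp
  qed
  have "((\<lambda>l. A + (1 - l) * D) \<longlongrightarrow> A + (1 - 0) * D) (at_right 0)"
    by (intro tendsto_intros)
  moreover have "\<forall>\<^sub>F l in at_right 0. A + (1 - l) * D \<le> B"
    using eventually_at_right_real[OF zero_less_one] by eventually_elim (use key in auto)
  ultimately have "A + (1 - 0) * D \<le> B"
    by (intro tendsto_upperbound) auto
  then show ?thesis by (simp add: A_def B_def D_def P_def)
qed

text \<open>Each of the two minimizers serves as the comparison point in the three-point inequality of the
  other; in the sum of the two inequalities the values of \<open>\<psi>\<close> cancel.\<close>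

lemma prox_step_nonexpansive:
  assumes pcc: "proper_closed_convex S \<psi>" and h: "h > 0"
    and a: "prox_step S \<psi> h v x a" and b: "prox_step S \<psi> h w y b"
  shows "norm (a - b) \<le> norm ((x - y) - h *\<^sub>R (v - w))"
proof -
  note 1 = prox_step_three_point[OF pcc a h prox_step_edom[OF pcc b]]
    and 2 = prox_step_three_point[OF pcc b h prox_step_edom[OF pcc a]]
  have "2 * (norm (a - b))\<^sup>2 / (2 * h)
      + ((norm (a - x))\<^sup>2 - (norm (b - x))\<^sup>2 + (norm (b - y))\<^sup>2 - (norm (a - y))\<^sup>2) / (2 * h)
      + inner (v - w) (a - b) \<le> 0"
    using 1 2 norm_minus_commute[of a b]
    by (simp add: inner_diff_left inner_diff_right add_divide_distrib diff_divide_distrib)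
  moreover have "(norm (a - x))\<^sup>2 - (norm (b - x))\<^sup>2 + (norm (b - y))\<^sup>2 - (norm (a - y))\<^sup>2
      = - 2 * inner (a - b) (x - y)"
    by (simp add: power2_norm_eq_inner inner_diff_left inner_diff_right inner_commute)
  ultimately have "(norm (a - b))\<^sup>2 - inner (a - b) (x - y) + h * inner (v - w) (a - b) \<le> 0"
    using h by (simp add: field_simps)
  then have "(norm (a - b))\<^sup>2 \<le> inner (a - b) ((x - y) - h *\<^sub>R (v - w))"
    by (simp add: inner_diff_right inner_diff_left inner_commute)
  also have "\<dots> \<le> norm (a - b) * norm ((x - y) - h *\<^sub>R (v - w))"
    by (rule norm_cauchy_schwarz)
  finally have "norm (a - b) * norm (a - b) \<le> norm (a - b) * norm ((x - y) - h *\<^sub>R (v - w))"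
    by (simp add: power2_eq_square)
  then show ?thesis
    by (cases "norm (a - b) = 0") (auto simp: mult_le_cancel_left)
qed

lemma subdifferential_monotone:
  assumes "v \<in> subdifferential S k x" "w \<in> subdifferential S k y" "x \<in> S" "y \<in> S"
  shows "inner (v - w) (x - y) \<ge> 0"
proof -
  have "k x + inner v (y - x) \<le> k y" "k y + inner w (x - y) \<le> k x"
    using assms by (auto simp: subdifferential_def)
  then show ?thesis
    by (simp add: inner_diff_left inner_diff_right)
qed

text \<open>Without smoothness a subgradient step need not be nonexpansive. Monotonicity only removes the cross
  term, so the price of a common function is quadratic in the stepsize, which over many steps adds
  up like a square root instead of linearly.\<close>

lemma prox_step_same_subgradient:
  assumes pcc: "proper_closed_convex S \<psi>" and h: "h > 0"
    and a: "prox_step S \<psi> h v x a" and b: "prox_step S \<psi> h w y b"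
    and v: "v \<in> subdifferential S k x" and w: "w \<in> subdifferential S k y"
    and S: "x \<in> S" "y \<in> S" and bound: "norm v \<le> L" "norm w \<le> L"
  shows "(norm (a - b))\<^sup>2 \<le> (norm (x - y))\<^sup>2 + h\<^sup>2 * (4 * L\<^sup>2)"
proof -
  have "(norm (a - b))\<^sup>2 \<le> (norm ((x - y) - h *\<^sub>R (v - w)))\<^sup>2"
    using prox_step_nonexpansive[OF pcc h a b] by (intro power_mono) auto
  also have "\<dots> = (norm (x - y))\<^sup>2 - 2 * h * inner (v - w) (x - y) + h\<^sup>2 * (norm (v - w))\<^sup>2"
    unfolding power2_norm_eq_inner power2_eq_square[of h]
    by (simp add: inner_diff_left inner_diff_right inner_commute algebra_simps)
  also have "\<dots> \<le> (norm (x - y))\<^sup>2 + h\<^sup>2 * (2 * L)\<^sup>2"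
  proof -
    have "norm (v - w) \<le> 2 * L"
      using norm_triangle_ineq4[of v w] bound by linarith
    then have "h\<^sup>2 * (norm (v - w))\<^sup>2 \<le> h\<^sup>2 * (2 * L)\<^sup>2"
      by (intro mult_left_mono power_mono) auto
    moreover have "2 * h * inner (v - w) (x - y) \<ge> 0"
      using subdifferential_monotone[OF v w S] h by simp
    ultimately show ?thesis by linarith
  qed
  finally show ?thesis by (simp add: power_mult_distrib)
qed

lemma prox_step_other_subgradient:
  assumes pcc: "proper_closed_convex S \<psi>" and h: "h > 0"
    and a: "prox_step S \<psi> h v x a" and b: "prox_step S \<psi> h w y b"
    and bound: "norm v \<le> L" "norm w \<le> M"
  shows "norm (a - b) \<le> norm (x - y) + h * (L + M)"
proof -
  have "norm (a - b) \<le> norm ((x - y) - h *\<^sub>R (v - w))"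
    by (rule prox_step_nonexpansive[OF pcc h a b])
  also have "\<dots> \<le> norm (x - y) + norm (h *\<^sub>R (v - w))"
    by (rule norm_triangle_ineq4)
  also have "norm (h *\<^sub>R (v - w)) \<le> h * (L + M)"
    using h norm_triangle_ineq4[of v w] bound by (auto intro!: mult_left_mono)
  finally show ?thesis by simp
qed

text \<open>Two functions enter: the step uses a subgradient of the sampled component \<open>k\<close>, while progress
  is measured by \<open>F\<close>. The error of this mismatch appears as a difference of the same quantity at
  \<open>x\<close> and at the reference point \<open>y\<close>. Passing from \<open>x\<close> to the new point \<open>x'\<close> costs \<open>M\<close> times their
  distance, with \<open>M\<close> in the role of a Lipschitz constant of \<open>F\<close>. Since \<open>\<psi>\<close> takes part in the step,
  this distance is not bounded by the subgradient, but the negative quadratic term of the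
  three-point inequality absorbs it.\<close>

lemma prox_step_descent:
  assumes pcc: "proper_closed_convex S \<psi>" and h: "h > 0"
    and step: "prox_step S \<psi> h v x x'"
    and v: "v \<in> subdifferential S k x" and vL: "norm v \<le> L"
    and y: "y \<in> edom S \<psi>"
    and F: "F x' \<le> F x + M * norm (x' - x)"
  shows "(F x' + real_of_ereal (\<psi> x')) - (F y + real_of_ereal (\<psi> y))
           \<le> (F x - k x) - (F y - k y)
              + ((norm (y - x))\<^sup>2 - (norm (y - x'))\<^sup>2) / (2 * h) + h * (L\<^sup>2 + M\<^sup>2)"
proof -
  define u where "u = norm (x' - x)"
  have "k x + inner v (y - x) \<le> k y"
    using v y by (auto simp: subdifferential_def edom_def)
  moreover have "inner v (x - x') \<le> L * u"
  proof -
    have "inner v (x - x') \<le> norm v * norm (x - x')" by (rule norm_cauchy_schwarz)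
    also have "\<dots> \<le> L * u"
      unfolding u_def norm_minus_commute[of x] using vL by (intro mult_right_mono) auto
    finally show ?thesis .
  qed
  moreover have "(L + M) * u - u\<^sup>2 / (2 * h) \<le> h * (L\<^sup>2 + M\<^sup>2)"
  proof -
    \<comment> \<open>the maximum over \<open>u\<close> is \<open>h (L + M)\<^sup>2 / 2\<close>, attained at \<open>u = h (L + M)\<close>\<close>
    have "0 \<le> (u - h * (L + M))\<^sup>2 + h\<^sup>2 * (L - M)\<^sup>2" by simp
    then have "2 * h * ((L + M) * u) - u\<^sup>2 \<le> 2 * h * (h * (L\<^sup>2 + M\<^sup>2))"
      by (simp add: power2_eq_square algebra_simps)
    then show ?thesis using h by (simp add: field_simps)
  qed
  moreover note prox_step_three_point[OF pcc step h y] F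
  ultimately show ?thesis
    unfolding u_def[symmetric]
    by (simp add: inner_diff_right algebra_simps diff_divide_distrib)
qed


section \<open>From suffix averages to the last iterate\<close>

text \<open>Let \<open>S\<^sub>k\<close> be the average of the last \<open>k\<close> values. The hypothesis for the suffix of length \<open>k\<close> says
  that \<open>S\<^sub>k\<close> exceeds the value preceding that suffix by at most \<open>B\<close>, so including that value lowers the
  average by at most \<open>B / (k + 1)\<close>. The sum of these losses is at most \<open>B ln T\<close>.\<close>

lemma last_iterate_le_average:
  fixes y :: "nat \<Rightarrow> real"
  assumes T: "T \<ge> 1" and B: "B \<ge> 0"
    and suffix: "\<And>s. s \<in> {1..T} \<Longrightarrow> (\<Sum>t=s..T. y (t + 1) - y s) \<le> real (T + 1 - s) * B"
  shows "y (T + 1) \<le> (\<Sum>t=1..T. y (t + 1)) / real T + B * ln (real T)"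
proof -
  have "y (T + 1) \<le> (\<Sum>t=T + 1 - k..T. y (t + 1)) / real k + B * ln (real k)"
    if "1 \<le> k" "k \<le> T" for k
    using that
  proof (induction k rule: dec_induct)
    case base
    then show ?case by simp
  next
    case (step k)
    define S where "S = (\<Sum>t=T + 1 - k..T. y (t + 1))"
    have k: "real k > 0" and kT: "k < T" using step by auto
    have IH: "y (T + 1) \<le> S / real k + B * ln (real k)"
      using step by (simp add: S_def)
    have "S - real k * y (T + 1 - k) \<le> real k * B"
    proof -
      have "T + 1 - k \<in> {1..T}" "T + 1 - (T + 1 - k) = k" using step kT by auto
      then show ?thesis
        using suffix[of "T + 1 - k"] by (simp add: S_def sum_subtractf)
    qed
    then have 1: "S / real k \<le> y (T + 1 - k) + B"
      using k by (simp add: field_simps)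
    have "(\<Sum>t=T + 1 - Suc k..T. y (t + 1)) = y (T + 1 - k) + S"
    proof -
      have "{T + 1 - Suc k..T} = insert (T - k) {T + 1 - k..T}" using kT by auto
      then show ?thesis using kT by (simp add: S_def Suc_diff_le)
    qed
    moreover have "S / real k \<le> (y (T + 1 - k) + S) / real (Suc k) + B / real (Suc k)"
    proof -
      have "S / real k * real (Suc k) = S + S / real k"
        using k by (simp add: field_simps)
      also have "\<dots> \<le> y (T + 1 - k) + S + B" using 1 by simp
      finally show ?thesis
        by (simp add: pos_le_divide_eq flip: add_divide_distrib)
    qed
    moreover have "B / real (Suc k) \<le> B * (ln (real (Suc k)) - ln (real k))"
    proof -
      have "ln (real k / real (Suc k)) \<le> real k / real (Suc k) - 1"
        using k by (intro ln_le_minus_one) auto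
      then have "1 / real (Suc k) \<le> ln (real (Suc k)) - ln (real k)"
        using k by (simp add: ln_div field_simps)
      then show ?thesis using B mult_left_mono by fastforce
    qed
    ultimately show ?case using IH by (simp add: algebra_simps)
  qed
  from this[of T] T show ?thesis by simp
qed


section \<open>Means over all permutations\<close>

definition perm_mean :: "nat \<Rightarrow> ((nat \<Rightarrow> nat) \<Rightarrow> real) \<Rightarrow> real" where
  "perm_mean n h = (\<Sum>p | p permutes {1..n}. h p) / fact n"

lemma finite_perms: "finite {p. p permutes {1..n::nat}}"
  by (simp add: finite_permutations)

lemma card_perms: "card {p. p permutes {1..n::nat}} = fact n"
  by (rule card_permutations) simp_all

lemma perm_mean_mono:
  "(\<And>p. p permutes {1..n} \<Longrightarrow> h p \<le> k p) \<Longrightarrow> perm_mean n h \<le> perm_mean n k"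
  unfolding perm_mean_def by (intro divide_right_mono sum_mono) auto

lemma perm_mean_cong:
  "(\<And>p. p permutes {1..n} \<Longrightarrow> h p = k p) \<Longrightarrow> perm_mean n h = perm_mean n k"
  unfolding perm_mean_def by (intro arg_cong2[where f = "(/)"] sum.cong) auto

lemma perm_mean_add: "perm_mean n (\<lambda>p. h p + k p) = perm_mean n h + perm_mean n k"
  by (simp add: perm_mean_def sum.distrib add_divide_distrib)

lemma perm_mean_diff: "perm_mean n (\<lambda>p. h p - k p) = perm_mean n h - perm_mean n k"
  by (simp add: perm_mean_def sum_subtractf diff_divide_distrib)

lemma perm_mean_cmult: "perm_mean n (\<lambda>p. c * h p) = c * perm_mean n h"
  by (simp add: perm_mean_def sum_distrib_left)

lemma perm_mean_divide: "perm_mean n (\<lambda>p. h p / c) = perm_mean n h / c"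
  by (simp add: perm_mean_def sum_divide_distrib mult.commute)

lemma perm_mean_const: "perm_mean n (\<lambda>p. c) = c"
  by (simp add: perm_mean_def card_perms del: One_nat_def)

lemma perm_mean_sum: "perm_mean n (\<lambda>p. \<Sum>i\<in>I. h i p) = (\<Sum>i\<in>I. perm_mean n (h i))"
  unfolding perm_mean_def by (subst sum.swap) (simp add: sum_divide_distrib)

lemma perm_mean_abs: "\<bar>perm_mean n h\<bar> \<le> perm_mean n (\<lambda>p. \<bar>h p\<bar>)"
  by (simp add: perm_mean_def abs_divide divide_right_mono sum_abs)

lemma perm_mean_transpose:
  assumes "a \<in> {1..n}" "b \<in> {1..n}"
  shows "perm_mean n (\<lambda>p. h (p \<circ> Transposition.transpose a b)) = perm_mean n h"
  unfolding perm_mean_def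
  by (subst sum_permutations_compose_right[OF permutes_swap_id[OF assms], of h]) (rule refl)

text \<open>By invariance under transpositions the mean does not depend on the position \<open>a\<close>, and the sum over
  all positions does not depend on the permutation.\<close>

lemma perm_mean_entry:
  assumes a: "a \<in> {1..n}"
  shows "perm_mean n (\<lambda>p. c (p a)) = (\<Sum>i=1..n. c i) / real n"
proof -
  have eq: "perm_mean n (\<lambda>p. c (p b)) = perm_mean n (\<lambda>p. c (p a))" if "b \<in> {1..n}" for b
    using perm_mean_transpose[OF a that, of "\<lambda>p. c (p a)"] by simp
  have "real n * perm_mean n (\<lambda>p. c (p a)) = (\<Sum>b=1..n. perm_mean n (\<lambda>p. c (p b)))"
    using eq by simp
  also have "\<dots> = perm_mean n (\<lambda>p. \<Sum>b=1..n. c (p b))"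
    by (rule perm_mean_sum[symmetric])
  also have "\<dots> = perm_mean n (\<lambda>p. \<Sum>i=1..n. c i)"
    by (intro perm_mean_cong) (metis sum.permute comp_def sum.cong)
  also have "\<dots> = (\<Sum>i=1..n. c i)" by (rule perm_mean_const)
  finally show ?thesis using a by (simp add: field_simps)
qed

lemma ereal_expectation_perm:
  assumes X: "\<And>p. p permutes {1..n} \<Longrightarrow> X p = ereal (h p)"
  shows "ereal_expectation (uniform_permutation n) X = ereal (perm_mean n h)"
proof -
  have ne: "{p. p permutes {1..n}} \<noteq> {}" using permutes_id by blast
  have fact: "(fact n :: ennreal) = ennreal (fact n)"
    by (metis ennreal_of_nat_eq_real_of_nat of_nat_fact)
  have *: "enn2ereal (\<integral>\<^sup>+ p. e2ennreal (Y p) \<partial>measure_pmf (uniform_permutation n))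
      = ereal (perm_mean n (\<lambda>p. max 0 (k p)))"
    if Y: "\<And>p. p permutes {1..n} \<Longrightarrow> Y p = ereal (k p)" for Y k
  proof -
    have "(\<integral>\<^sup>+ p. e2ennreal (Y p) \<partial>measure_pmf (uniform_permutation n))
        = (\<Sum>p | p permutes {1..n}. e2ennreal (Y p)) / ennreal (fact n)"
      unfolding uniform_permutation_def
      by (subst nn_integral_pmf_of_set[OF ne finite_perms])
        (simp add: card_perms fact del: One_nat_def)
    also have "(\<Sum>p | p permutes {1..n}. e2ennreal (Y p))
        = (\<Sum>p | p permutes {1..n}. ennreal (max 0 (k p)))"
      by (intro sum.cong) (auto simp: Y e2ennreal_ereal max_def ennreal_neg)
    also have "\<dots> = ennreal (\<Sum>p | p permutes {1..n}. max 0 (k p))"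
      by (rule sum_ennreal) simp
    also have "\<dots> / ennreal (fact n) = ennreal (perm_mean n (\<lambda>p. max 0 (k p)))"
      unfolding perm_mean_def by (intro divide_ennreal) (auto intro: sum_nonneg)
    finally show ?thesis
      by (simp add: perm_mean_def sum_nonneg)
  qed
  have "ereal_expectation (uniform_permutation n) X
      = ereal (perm_mean n (\<lambda>p. max 0 (h p)) - perm_mean n (\<lambda>p. max 0 (- h p)))"
    unfolding ereal_expectation_def
    by (subst *[of X h], simp add: X, subst *[of "\<lambda>p. - X p" "\<lambda>p. - h p"]) (simp_all add: X)
  also have "perm_mean n (\<lambda>p. max 0 (h p)) - perm_mean n (\<lambda>p. max 0 (- h p)) = perm_mean n h"
    unfolding perm_mean_diff[symmetric] by (intro perm_mean_cong) auto
  finally show ?thesis .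
qed

text \<open>This covers comparison points outside the domain of \<open>\<psi>\<close>.\<close>

lemma ereal_expectation_perm_MInf:
  assumes X: "\<And>p. p permutes {1..n} \<Longrightarrow> X p = -\<infinity>"
  shows "ereal_expectation (uniform_permutation n) X = -\<infinity>"
proof -
  have ne: "{p. p permutes {1..n}} \<noteq> {}" using permutes_id by blast
  have AE: "AE p in measure_pmf (uniform_permutation n). X p = -\<infinity>"
    using X unfolding AE_measure_pmf_iff uniform_permutation_def set_pmf_of_set[OF ne finite_perms]
    by blast
  have "(\<integral>\<^sup>+ p. e2ennreal (X p) \<partial>measure_pmf (uniform_permutation n))
      = (\<integral>\<^sup>+ p. 0 \<partial>measure_pmf (uniform_permutation n))"
    by (intro nn_integral_cong_AE) (use AE in eventually_elim, auto simp: e2ennreal_neg)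
  moreover have "(\<integral>\<^sup>+ p. e2ennreal (- X p) \<partial>measure_pmf (uniform_permutation n))
      = (\<integral>\<^sup>+ p. \<top> \<partial>measure_pmf (uniform_permutation n))"
    by (intro nn_integral_cong_AE) (use AE in eventually_elim, auto simp: e2ennreal_infty)
  ultimately show ?thesis
    by (simp add: ereal_expectation_def zero_ennreal.rep_eq top_ennreal.rep_eq)
qed


section \<open>Epochs\<close>

lemma r_epoch_eq:
  assumes "n \<ge> 1" "t \<ge> 1"
  shows "q_epoch n t = Suc ((t - 1) div n)" "r_epoch n t = Suc ((t - 1) mod n)"
proof -
  define k r where "k = (t - 1) div n" and "r = (t - 1) mod n"
  have t: "t = n * k + r + 1" and r: "r < n"
    using assms by (auto simp: k_def r_def)
  have "\<lceil>real t / real n\<rceil> = int (Suc k)"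
  proof -
    have "real r + 1 \<le> real n" using r by linarith
    then show ?thesis
      using assms(1) by (auto simp: ceiling_eq_iff t field_simps)
  qed
  then show q: "q_epoch n t = Suc ((t - 1) div n)"
    by (simp add: q_epoch_def k_def)
  show "r_epoch n t = Suc ((t - 1) mod n)"
    unfolding r_epoch_def q k_def[symmetric] r_def[symmetric] by (simp add: t mult.commute)
qed

lemma r_epoch_range:
  assumes "n \<ge> 1" "t \<ge> 1"
  shows "r_epoch n t \<in> {1..n}"
  using assms by (simp add: r_epoch_eq Suc_le_eq)

text \<open>The last epoch may be incomplete; for nonnegative summands it can be completed.\<close>

lemma sum_r_epoch_le:
  fixes c :: "nat \<Rightarrow> real"
  assumes n: "n \<ge> 1" and T: "T \<ge> 1" and c: "\<And>j. j \<in> {1..n} \<Longrightarrow> c j \<ge> 0"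
  shows "(\<Sum>t=1..T. c (r_epoch n t)) \<le> real (q_epoch n T) * (\<Sum>j=1..n. c j)"
proof -
  define q where "q = q_epoch n T"
  \<comment> \<open>\<open>T\<close> lies in the last of the \<open>q\<close> epochs\<close>
  have "(T - 1) mod n < n" using n by simp
  then have Tq: "T \<le> q * n"
    using div_mult_mod_eq[of "T - 1" n] T unfolding q_def r_epoch_eq(1)[OF n T] mult_Suc by linarith
  have "(\<Sum>t=1..T. c (r_epoch n t)) = (\<Sum>m<T. c (Suc (m mod n)))"
    by (rule sum.reindex_bij_witness[of _ Suc "\<lambda>t. t - 1"]) (use n in \<open>auto simp: r_epoch_eq\<close>)
  also have "\<dots> \<le> (\<Sum>m<q * n. c (Suc (m mod n)))"
    using Tq n by (intro sum_mono2) (auto simp: c Suc_le_eq)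
  also have "\<dots> = (\<Sum>k<q. \<Sum>m=k * n..<k * n + n. c (Suc (m mod n)))"
    by (rule sum.nat_group[symmetric])
  also have "\<dots> = (\<Sum>k<q. \<Sum>j=1..n. c j)"
  proof (rule sum.cong[OF refl])
    fix k
    have "(\<Sum>m=k * n..<k * n + n. c (Suc (m mod n))) = (\<Sum>j=0..<n. c (Suc j))"
      by (subst sum.atLeastLessThan_shift_0) simp
    also have "\<dots> = (\<Sum>j=1..n. c j)"
      by (rule sum.reindex_bij_witness[of _ "\<lambda>j. j - 1" Suc]) auto
    finally show "(\<Sum>m=k * n..<k * n + n. c (Suc (m mod n))) = (\<Sum>j=1..n. c j)" .
  qed
  finally show ?thesis by (simp add: q_def)
qed


section \<open>The single shuffle method\<close>

locale composite =
  fixes d n :: nat and f :: "nat \<Rightarrow> fin_seq \<Rightarrow> real" and g :: "nat \<Rightarrow> fin_seq \<Rightarrow> fin_seq"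
    and \<psi> :: "fin_seq \<Rightarrow> ereal" and G :: "nat \<Rightarrow> real" and T :: nat
  assumes problem: "composite_problem d n f g \<psi> G" and T: "T \<ge> 1"
begin

definition fbar :: "fin_seq \<Rightarrow> real" where
  "fbar w = (\<Sum>i=1..n. f i w) / real n"

definition Fbar :: "fin_seq \<Rightarrow> real" where
  "Fbar w = fbar w + real_of_ereal (\<psi> w)"

text \<open>\<open>ss_noise\<close> without its factor \<open>1 + ln T\<close>.\<close>

definition noise :: real where
  "noise = max (real (q_epoch n T) * (Gf2 n G)\<^sup>2)
               (sqrt (real n * real (q_epoch n T)) * Gf1 n G * Gf2 n G)"

lemma n: "n \<ge> 1"
  and pcc: "proper_closed_convex (Rd d) \<psi>"
  using problem by (auto simp: composite_problem_def)

lemma component: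
  assumes "i \<in> {1..n}"
  shows "w \<in> Rd d \<Longrightarrow> g i w \<in> subdifferential (Rd d) (f i) w"
    and "G i > 0"
    and "(G i)-lipschitz_on (edom (Rd d) \<psi>) (f i)"
    and "w \<in> edom (Rd d) \<psi> \<Longrightarrow> norm (g i w) \<le> G i"
  using problem assms by (auto simp: composite_problem_def)

lemma edom_Rd: "w \<in> edom (Rd d) \<psi> \<Longrightarrow> w \<in> Rd d"
  by (simp add: edom_def)

lemma f_diff_le:
  assumes "i \<in> {1..n}" "v \<in> edom (Rd d) \<psi>" "w \<in> edom (Rd d) \<psi>"
  shows "\<bar>f i v - f i w\<bar> \<le> G i * norm (v - w)"
  using lipschitz_onD[OF component(3)[OF assms(1)] assms(2,3)] by (simp add: dist_norm)

lemma fbar_diff_le: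
  assumes "v \<in> edom (Rd d) \<psi>" "w \<in> edom (Rd d) \<psi>"
  shows "fbar v \<le> fbar w + Gf1 n G * norm (v - w)"
proof -
  have "(\<Sum>i=1..n. f i v) \<le> (\<Sum>i=1..n. f i w + G i * norm (v - w))"
    using f_diff_le[OF _ assms] by (intro sum_mono) (smt (verit))
  then show ?thesis
    by (simp add: fbar_def Gf1_def sum.distrib sum_distrib_right divide_right_mono
        flip: add_divide_distrib)
qed

lemma Gf2_sq: "(Gf2 n G)\<^sup>2 = (\<Sum>i=1..n. (G i)\<^sup>2) / real n"
  unfolding Gf2_def by (rule real_sqrt_pow2) (auto intro!: divide_nonneg_nonneg sum_nonneg)

lemma Gf2_pos: "Gf2 n G > 0"
  unfolding Gf2_def using n
  by (intro real_sqrt_gt_zero divide_pos_pos sum_pos zero_less_power component(2)) auto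

lemma Gf1_sq_le: "(Gf1 n G)\<^sup>2 \<le> (Gf2 n G)\<^sup>2"
proof -
  have "(\<Sum>i=1..n. G i)\<^sup>2 \<le> (\<Sum>i=1..n. (G i)\<^sup>2) * real n"
    using sum_squared_le_sum_of_squares[of G "{1..n}"] by simp
  then show ?thesis
    using n by (simp add: Gf1_def Gf2_sq power_divide power2_eq_square[of "real n"] field_simps)
qed

lemma q_pos: "q_epoch n T \<ge> 1"
  using n T by (simp add: r_epoch_eq)

lemma Gf2_sq_le_noise: "(Gf2 n G)\<^sup>2 \<le> noise"
proof -
  have "1 * (Gf2 n G)\<^sup>2 \<le> real (q_epoch n T) * (Gf2 n G)\<^sup>2"
    using q_pos by (intro mult_right_mono) auto
  then show ?thesis by (simp add: noise_def)
qed

lemma noise_pos: "noise > 0"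
  using Gf2_sq_le_noise Gf2_pos by (smt (verit) zero_less_power)

end

locale single_shuffle = composite +
  fixes x1 :: fin_seq and h :: real and x :: "(nat \<Rightarrow> nat) \<Rightarrow> nat \<Rightarrow> fin_seq"
  assumes x1: "x1 \<in> edom (Rd d) \<psi>"
    and h: "h > 0"
    and iterates: "\<And>p. p permutes {1..n} \<Longrightarrow>
      prox_gradient_iterates d g \<psi> x1 T (\<lambda>t. h) (ss_index n p) (x p)"
begin

lemma iterate_step:
  assumes "p permutes {1..n}" "t \<in> {1..T}"
  shows "prox_step (Rd d) \<psi> h (g (p (r_epoch n t)) (x p t)) (x p t) (x p (t + 1))"
  using iterates[OF assms(1)] assms(2)
  by (auto simp: prox_gradient_iterates_def prox_step_def ss_index_def)

lemma x_first: "p permutes {1..n} \<Longrightarrow> x p 1 = x1"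
  using iterates by (auto simp: prox_gradient_iterates_def)

lemma x_edom:
  assumes "p permutes {1..n}" "t \<in> {1..T + 1}"
  shows "x p t \<in> edom (Rd d) \<psi>"
proof (cases "t = 1")
  case True
  then show ?thesis using x1 x_first[OF assms(1)] by simp
next
  case False
  then have "t - 1 \<in> {1..T}" "t - 1 + 1 = t" using assms(2) by auto
  then show ?thesis using prox_step_edom[OF pcc iterate_step[OF assms(1), of "t - 1"]] by metis
qed

lemma entry_range:
  assumes "p permutes {1..n}" "t \<in> {1..T}"
  shows "p (r_epoch n t) \<in> {1..n}"
  using permutes_in_image[OF assms(1)] r_epoch_range[OF n] assms(2) by auto

text \<open>The bound has the form \<open>\<surd>s + e\<close>, where \<open>s\<close> collects the steps with a common function and \<open>e\<close> those
  with different ones. This form is preserved by both kinds of steps: adding \<open>c\<close> to the square of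
  \<open>\<surd>s + e\<close> gives at most the square of \<open>\<surd>(s + c) + e\<close>.\<close>

lemma iterates_stable_sum:
  assumes p: "p permutes {1..n}" and a: "a \<in> {1..n}" and b: "b \<in> {1..n}"
  defines "p' \<equiv> p \<circ> Transposition.transpose a b"
  assumes t: "1 \<le> t" "t \<le> T + 1"
  shows "norm (x p t - x p' t)
    \<le> h * (sqrt (\<Sum>u=1..<t. 4 * (G (p (r_epoch n u)))\<^sup>2)
           + (\<Sum>u=1..<t. if r_epoch n u \<in> {a, b} then G (p a) + G (p b) else 0))"
  using t
proof (induction t rule: dec_induct)
  case base
  have p': "p' permutes {1..n}"
    unfolding p'_def by (intro permutes_compose permutes_swap_id a b p)
  show ?case using x_first[OF p] x_first[OF p'] by simp
next
  case (step t)
  have p': "p' permutes {1..n}"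
    unfolding p'_def by (intro permutes_compose permutes_swap_id a b p)
  define s where "s = (\<Sum>u=1..<t. 4 * (G (p (r_epoch n u)))\<^sup>2)"
  define w where "w = G (p a) + G (p b)"
  define e where "e = (\<Sum>u=1..<t. if r_epoch n u \<in> {a, b} then w else 0)"
  define c where "c = 4 * (G (p (r_epoch n t)))\<^sup>2"
  have tT: "t \<in> {1..T}" "t \<in> {1..T + 1}" using step by auto
  have pab: "p a \<in> {1..n}" "p b \<in> {1..n}" using permutes_in_image[OF p] a b by auto
  have s: "s \<ge> 0" unfolding s_def by (intro sum_nonneg) auto
  have w: "w \<ge> 0" unfolding w_def using component(2)[OF pab(1)] component(2)[OF pab(2)] by simp
  have e: "e \<ge> 0" unfolding e_def using w by (intro sum_nonneg) auto
  have c: "c \<ge> 0" by (simp add: c_def)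
  have IH: "norm (x p t - x p' t) \<le> h * (sqrt s + e)"
    unfolding s_def e_def w_def using step by simp
  note steps = iterate_step[OF p tT(1)] iterate_step[OF p' tT(1)]
  note dom = x_edom[OF p tT(2)] x_edom[OF p' tT(2)]
  note rng = entry_range[OF p tT(1)] entry_range[OF p' tT(1)]
  have s': "(\<Sum>u=1..<Suc t. 4 * (G (p (r_epoch n u)))\<^sup>2) = s + c"
    using step by (simp add: s_def c_def)
  have e': "(\<Sum>u=1..<Suc t. if r_epoch n u \<in> {a, b} then G (p a) + G (p b) else 0)
      = e + (if r_epoch n t \<in> {a, b} then w else 0)"
    unfolding e_def w_def using step by simp
  show ?case
  proof (cases "r_epoch n t \<in> {a, b}")
    case True
    have "G (p (r_epoch n t)) + G (p' (r_epoch n t)) = w"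
      using True by (auto simp: p'_def w_def)
    then have "norm (x p (t + 1) - x p' (t + 1)) \<le> norm (x p t - x p' t) + h * w"
      using prox_step_other_subgradient[OF pcc h steps
          component(4)[OF rng(1) dom(1)] component(4)[OF rng(2) dom(2)]] by simp
    also have "\<dots> \<le> h * (sqrt (s + c) + (e + w))"
    proof -
      have "h * sqrt s \<le> h * sqrt (s + c)" using c h by simp
      then show ?thesis using IH by (simp add: algebra_simps)
    qed
    finally show ?thesis unfolding s' e' using True by simp
  next
    case False
    then have eq: "p' (r_epoch n t) = p (r_epoch n t)"
      by (simp add: p'_def transpose_def)
    have "(norm (x p (t + 1) - x p' (t + 1)))\<^sup>2 \<le> (norm (x p t - x p' t))\<^sup>2 + h\<^sup>2 * c"
      unfolding c_def
      by (rule prox_step_same_subgradient[OF pcc h steps(1) steps(2)[unfolded eq]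
            component(1)[OF rng(1) edom_Rd[OF dom(1)]] component(1)[OF rng(1) edom_Rd[OF dom(2)]]
            edom_Rd[OF dom(1)] edom_Rd[OF dom(2)]
            component(4)[OF rng(1) dom(1)] component(4)[OF rng(1) dom(2)]])
    also have "\<dots> \<le> (h * (sqrt s + e))\<^sup>2 + h\<^sup>2 * c"
      using IH by (intro add_right_mono power_mono) auto
    also have "\<dots> = h\<^sup>2 * (s + c + 2 * (e * sqrt s) + e\<^sup>2)"
      using s by (simp add: power_mult_distrib power2_sum algebra_simps power2_eq_square[of h])
    also have "\<dots> \<le> h\<^sup>2 * (s + c + 2 * (e * sqrt (s + c)) + e\<^sup>2)"
      using e c s by (intro mult_left_mono add_mono) auto
    also have "\<dots> = (h * (sqrt (s + c) + e))\<^sup>2"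
      using s c by (simp add: power_mult_distrib power2_sum algebra_simps power2_eq_square[of h])
    finally have "norm (x p (t + 1) - x p' (t + 1)) \<le> h * (sqrt (s + c) + e)"
      by (rule power2_le_imp_le) (use h s c e in simp)
    then show ?thesis unfolding s' e' using False by simp
  qed
qed

lemma iterates_stable:
  assumes p: "p permutes {1..n}" and a: "a \<in> {1..n}" and b: "b \<in> {1..n}"
    and t: "t \<in> {1..T + 1}"
  shows "norm (x p t - x (p \<circ> Transposition.transpose a b) t)
    \<le> 2 * h * (sqrt (real n * real (q_epoch n T)) * Gf2 n G
               + real (q_epoch n T) * (G (p a) + G (p b)))"
proof -
  define w where "w = G (p a) + G (p b)"
  have pab: "p a \<in> {1..n}" "p b \<in> {1..n}" using permutes_in_image[OF p] a b by auto
  have w: "w \<ge> 0" unfolding w_def using component(2)[OF pab(1)] component(2)[OF pab(2)] by simp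
  have "(\<Sum>u=1..<t. 4 * (G (p (r_epoch n u)))\<^sup>2) \<le> (\<Sum>u=1..T. 4 * (G (p (r_epoch n u)))\<^sup>2)"
    using t by (intro sum_mono2) auto
  also have "\<dots> \<le> real (q_epoch n T) * (\<Sum>j=1..n. 4 * (G (p j))\<^sup>2)"
    by (rule sum_r_epoch_le[OF n T]) simp
  also have "(\<Sum>j=1..n. 4 * (G (p j))\<^sup>2) = (\<Sum>j=1..n. 4 * (G j)\<^sup>2)"
    using sum.permute[OF p, of "\<lambda>j. 4 * (G j)\<^sup>2"] by (simp add: comp_def)
  also have "real (q_epoch n T) * \<dots> = 2\<^sup>2 * (real n * real (q_epoch n T)) * (Gf2 n G)\<^sup>2"
    using n by (simp add: Gf2_sq flip: sum_distrib_left)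
  finally have "sqrt (\<Sum>u=1..<t. 4 * (G (p (r_epoch n u)))\<^sup>2)
      \<le> sqrt (2\<^sup>2 * (real n * real (q_epoch n T)) * (Gf2 n G)\<^sup>2)"
    by (rule real_sqrt_le_mono)
  also have "\<dots> = 2 * (sqrt (real n * real (q_epoch n T)) * Gf2 n G)"
    using Gf2_pos by (simp add: real_sqrt_mult)
  finally have 1: "sqrt (\<Sum>u=1..<t. 4 * (G (p (r_epoch n u)))\<^sup>2)
      \<le> 2 * (sqrt (real n * real (q_epoch n T)) * Gf2 n G)" .
  have "(\<Sum>u=1..<t. if r_epoch n u \<in> {a, b} then w else 0)
      \<le> (\<Sum>u=1..T. if r_epoch n u \<in> {a, b} then w else 0)"
    using t w by (intro sum_mono2) auto
  also have "\<dots> \<le> real (q_epoch n T) * (\<Sum>j=1..n. if j \<in> {a, b} then w else 0)"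
    by (rule sum_r_epoch_le[OF n T]) (use w in simp)
  also have "(\<Sum>j=1..n. if j \<in> {a, b} then w else 0) = real (card {a, b}) * w"
  proof -
    have "{1..n} \<inter> {j. j \<in> {a, b}} = {a, b}" using a b by auto
    then show ?thesis
      by (simp only: sum.If_cases[OF finite_atLeastAtMost] sum.neutral_const sum_constant add_0_right)
  qed
  also have "\<dots> \<le> 2 * w"
    using w card_insert_le_m1[of 2 "{b}" a] by (intro mult_right_mono) auto
  finally have "(\<Sum>u=1..<t. if r_epoch n u \<in> {a, b} then w else 0)
      \<le> real (q_epoch n T) * (2 * w)"
    by (meson mult_left_mono of_nat_0_le_iff)
  note 2 = this[unfolded w_def]
  have "norm (x p t - x (p \<circ> Transposition.transpose a b) t)
      \<le> h * (2 * (sqrt (real n * real (q_epoch n T)) * Gf2 n G) + real (q_epoch n T) * (2 * (G (p a) + G (p b))))"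
    using t h 1 2
    by (intro order.trans[OF iterates_stable_sum[OF p a b]] mult_left_mono add_mono) auto
  then show ?thesis by (simp add: algebra_simps)
qed

text \<open>Reindexing by the transposition of \<open>a\<close> and \<open>b\<close> makes the component functions on both sides equal
  and moves the difference into the iterates, where stability applies.\<close>

lemma perm_mean_swap_bias:
  assumes a: "a \<in> {1..n}" and b: "b \<in> {1..n}" and t: "t \<in> {1..T + 1}"
  shows "\<bar>perm_mean n (\<lambda>p. f (p a) (x p t)) - perm_mean n (\<lambda>p. f (p b) (x p t))\<bar> \<le> 6 * h * noise"
proof -
  define q where "q = real (q_epoch n T)"
  define R where "R = sqrt (real n * q) * Gf2 n G"
  let ?p' = "\<lambda>p. p \<circ> Transposition.transpose a b"
  have "perm_mean n (\<lambda>p. f (p a) (x p t)) = perm_mean n (\<lambda>p. f (p b) (x (?p' p) t))"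
    using perm_mean_transpose[OF a b, of "\<lambda>p. f (p a) (x p t)"] by simp
  then have "\<bar>perm_mean n (\<lambda>p. f (p a) (x p t)) - perm_mean n (\<lambda>p. f (p b) (x p t))\<bar>
      = \<bar>perm_mean n (\<lambda>p. f (p b) (x (?p' p) t) - f (p b) (x p t))\<bar>"
    by (simp add: perm_mean_diff)
  also have "\<dots> \<le> perm_mean n (\<lambda>p. \<bar>f (p b) (x (?p' p) t) - f (p b) (x p t)\<bar>)"
    by (rule perm_mean_abs)
  also have "\<dots> \<le> perm_mean n (\<lambda>p. 2 * h * (R * G (p b))
      + h * q * ((G (p a))\<^sup>2 + 3 * (G (p b))\<^sup>2))"
  proof (rule perm_mean_mono)
    fix p assume p: "p permutes {1..n}"
    have p': "?p' p permutes {1..n}" by (intro permutes_compose permutes_swap_id a b p)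
    have pb: "p b \<in> {1..n}" using permutes_in_image[OF p] b by auto
    have "\<bar>f (p b) (x (?p' p) t) - f (p b) (x p t)\<bar> \<le> G (p b) * norm (x p t - x (?p' p) t)"
      using f_diff_le[OF pb x_edom[OF p' t] x_edom[OF p t]] by (simp add: norm_minus_commute)
    also have "\<dots> \<le> G (p b) * (2 * h * (R + q * (G (p a) + G (p b))))"
      using iterates_stable[OF p a b t] component(2)[OF pb]
      by (intro mult_left_mono) (auto simp: R_def q_def)
    also have "\<dots> = 2 * h * (R * G (p b)) + h * q * (2 * G (p a) * G (p b) + 2 * (G (p b))\<^sup>2)"
      by (simp add: algebra_simps power2_eq_square)
    also have "\<dots> \<le> 2 * h * (R * G (p b)) + h * q * ((G (p a))\<^sup>2 + 3 * (G (p b))\<^sup>2)"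
      using sum_squares_bound[of "G (p a)" "G (p b)"] h
      by (intro add_left_mono mult_left_mono) (auto simp: q_def)
    finally show "\<bar>f (p b) (x (?p' p) t) - f (p b) (x p t)\<bar>
      \<le> 2 * h * (R * G (p b)) + h * q * ((G (p a))\<^sup>2 + 3 * (G (p b))\<^sup>2)" .
  qed
  also have "\<dots> = 2 * h * (R * Gf1 n G) + 4 * h * (q * (Gf2 n G)\<^sup>2)"
    by (simp only: perm_mean_add perm_mean_cmult perm_mean_entry[OF a, of "\<lambda>i. (G i)\<^sup>2"]
        perm_mean_entry[OF b, of "\<lambda>i. (G i)\<^sup>2"] perm_mean_entry[OF b, of G])
      (simp add: Gf1_def Gf2_sq)
  also have "\<dots> \<le> 2 * h * noise + 4 * h * noise"
    using h by (intro add_mono mult_left_mono) (auto simp: noise_def R_def q_def mult_ac)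
  finally show ?thesis by simp
qed

text \<open>For every permutation \<open>f\<close> is the average of its components over the positions, so the bias is an
  average of the differences between two positions.\<close>

lemma selection_bias:
  assumes a: "a \<in> {1..n}" and t: "t \<in> {1..T + 1}"
  shows "\<bar>perm_mean n (\<lambda>p. f (p a) (x p t) - fbar (x p t))\<bar> \<le> 6 * h * noise"
proof -
  have "perm_mean n (\<lambda>p. fbar (x p t)) = perm_mean n (\<lambda>p. (\<Sum>b=1..n. f (p b) (x p t)) / real n)"
  proof (rule perm_mean_cong)
    fix p assume p: "p permutes {1..n}"
    show "fbar (x p t) = (\<Sum>b=1..n. f (p b) (x p t)) / real n"
      using sum.permute[OF p, of "\<lambda>i. f i (x p t)"] by (simp add: fbar_def comp_def)
  qed
  also have "\<dots> = (\<Sum>b=1..n. perm_mean n (\<lambda>p. f (p b) (x p t))) / real n"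
    by (simp add: perm_mean_divide perm_mean_sum)
  finally have "perm_mean n (\<lambda>p. f (p a) (x p t) - fbar (x p t))
      = (\<Sum>b=1..n. perm_mean n (\<lambda>p. f (p a) (x p t)) - perm_mean n (\<lambda>p. f (p b) (x p t))) / real n"
    using n by (simp add: perm_mean_diff sum_subtractf diff_divide_distrib)
  also have "\<bar>\<dots>\<bar> \<le> (\<Sum>b=1..n. 6 * h * noise) / real n"
    unfolding abs_divide abs_of_nat
    by (intro divide_right_mono order.trans[OF sum_abs] sum_mono perm_mean_swap_bias a t) auto
  also have "\<dots> = 6 * h * noise" using n by simp
  finally show ?thesis .
qed

text \<open>The reference point \<open>w\<close> may depend on the permutation, since it will be an earlier iterate; its
  own selection bias is a hypothesis.\<close>

lemma expected_step:
  assumes t: "t \<in> {1..T}" and w: "\<And>p. p permutes {1..n} \<Longrightarrow> w p \<in> edom (Rd d) \<psi>"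
    and bias: "perm_mean n (\<lambda>p. f (p (r_epoch n t)) (w p) - fbar (w p)) \<le> \<beta>"
  defines "D \<equiv> \<lambda>u. perm_mean n (\<lambda>p. (norm (w p - x p u))\<^sup>2)"
  shows "perm_mean n (\<lambda>p. Fbar (x p (t + 1)) - Fbar (w p))
           \<le> (D t - D (t + 1)) / (2 * h) + (8 * h * noise + \<beta>)"
proof -
  let ?r = "r_epoch n t"
  have r: "?r \<in> {1..n}" using r_epoch_range[OF n] t by auto
  have tt: "t \<in> {1..T + 1}" "t + 1 \<in> {1..T + 1}" using t by auto
  have "perm_mean n (\<lambda>p. Fbar (x p (t + 1)) - Fbar (w p))
    \<le> perm_mean n (\<lambda>p. (fbar (x p t) - f (p ?r) (x p t)) - (fbar (w p) - f (p ?r) (w p))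
        + ((norm (w p - x p t))\<^sup>2 - (norm (w p - x p (t + 1)))\<^sup>2) / (2 * h)
        + h * ((G (p ?r))\<^sup>2 + (Gf1 n G)\<^sup>2))"
  proof (rule perm_mean_mono)
    fix p assume p: "p permutes {1..n}"
    note i = entry_range[OF p t] and dom = x_edom[OF p tt(1)]
    show "Fbar (x p (t + 1)) - Fbar (w p)
       \<le> (fbar (x p t) - f (p ?r) (x p t)) - (fbar (w p) - f (p ?r) (w p))
        + ((norm (w p - x p t))\<^sup>2 - (norm (w p - x p (t + 1)))\<^sup>2) / (2 * h)
        + h * ((G (p ?r))\<^sup>2 + (Gf1 n G)\<^sup>2)"
      unfolding Fbar_def
      by (rule prox_step_descent[OF pcc h iterate_step[OF p t] component(1)[OF i edom_Rd[OF dom]]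
            component(4)[OF i dom] w[OF p] fbar_diff_le[OF x_edom[OF p tt(2)] dom]])
  qed
  also have "\<dots> = perm_mean n (\<lambda>p. f (p ?r) (w p) - fbar (w p))
      - perm_mean n (\<lambda>p. f (p ?r) (x p t) - fbar (x p t))
      + (D t - D (t + 1)) / (2 * h) + h * ((Gf2 n G)\<^sup>2 + (Gf1 n G)\<^sup>2)"
    by (simp only: perm_mean_add perm_mean_diff perm_mean_divide perm_mean_cmult perm_mean_const
        perm_mean_entry[OF r, of "\<lambda>i. (G i)\<^sup>2"] Gf2_sq D_def)
  also have "\<dots> \<le> (D t - D (t + 1)) / (2 * h) + (8 * h * noise + \<beta>)"
  proof -
    have "h * ((Gf2 n G)\<^sup>2 + (Gf1 n G)\<^sup>2) \<le> h * (2 * noise)"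
      using h Gf1_sq_le Gf2_sq_le_noise by (intro mult_left_mono) auto
    then show ?thesis using selection_bias[OF r tt(1)] bias by linarith
  qed
  finally show ?thesis .
qed

lemma expected_suffix:
  assumes s: "s \<in> {1..T}" and w: "\<And>p. p permutes {1..n} \<Longrightarrow> w p \<in> edom (Rd d) \<psi>"
    and bias: "\<And>a. a \<in> {1..n} \<Longrightarrow> perm_mean n (\<lambda>p. f (p a) (w p) - fbar (w p)) \<le> \<beta>"
  shows "(\<Sum>t=s..T. perm_mean n (\<lambda>p. Fbar (x p (t + 1)) - Fbar (w p)))
           \<le> perm_mean n (\<lambda>p. (norm (w p - x p s))\<^sup>2) / (2 * h)
              + real (T + 1 - s) * (8 * h * noise + \<beta>)"
proof -
  define D where "D u = perm_mean n (\<lambda>p. (norm (w p - x p u))\<^sup>2)" for u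
  have "(\<Sum>t=s..T. perm_mean n (\<lambda>p. Fbar (x p (t + 1)) - Fbar (w p)))
      \<le> (\<Sum>t=s..T. (D t - D (t + 1)) / (2 * h) + (8 * h * noise + \<beta>))"
    unfolding D_def using s n
    by (intro sum_mono expected_step w bias r_epoch_range) auto
  also have "\<dots> = (\<Sum>t=s..T. D t - D (t + 1)) / (2 * h) + real (T + 1 - s) * (8 * h * noise + \<beta>)"
    by (simp add: sum.distrib sum_divide_distrib)
  also have "(\<Sum>t=s..T. D t - D (t + 1)) = D s - D (T + 1)"
    using sum_Suc_diff[of s T "\<lambda>t. - D t"] s by simp
  also have "(D s - D (T + 1)) / (2 * h) \<le> D s / (2 * h)"
  proof -
    have "perm_mean n (\<lambda>p. 0) \<le> D (T + 1)"
      unfolding D_def by (rule perm_mean_mono) simp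
    then have "D (T + 1) \<ge> 0" by (simp add: perm_mean_const)
    then show ?thesis using h by (intro divide_right_mono) auto
  qed
  finally show ?thesis by (simp add: D_def)
qed

text \<open>The reference point \<open>x\<^sub>s\<close> has selection bias at most \<open>6 h\<close> times the noise and no initial
  distance; the constant \<open>14\<close> is this \<open>6\<close> plus the \<open>8\<close> of a single step. The reference point \<open>z\<close> is
  deterministic, hence unbiased.\<close>

lemma last_iterate_bound:
  assumes z: "z \<in> edom (Rd d) \<psi>"
  shows "perm_mean n (\<lambda>p. Fbar (x p (T + 1)) - Fbar z)
           \<le> (norm (z - x1))\<^sup>2 / (2 * h * real T) + 14 * h * noise * (1 + ln (real T))"
proof -
  define y where "y t = perm_mean n (\<lambda>p. Fbar (x p t) - Fbar z)" for t
  define B where "B = 14 * h * noise"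
  have B: "B \<ge> 0" using h noise_pos by (simp add: B_def)
  have "(\<Sum>t=s..T. y (t + 1) - y s) \<le> real (T + 1 - s) * B" if s: "s \<in> {1..T}" for s
  proof -
    have s': "s \<in> {1..T + 1}" using s by auto
    have "(\<Sum>t=s..T. y (t + 1) - y s) = (\<Sum>t=s..T. perm_mean n (\<lambda>p. Fbar (x p (t + 1)) - Fbar (x p s)))"
      by (simp add: y_def perm_mean_diff)
    also have "\<dots> \<le> perm_mean n (\<lambda>p. (norm (x p s - x p s))\<^sup>2) / (2 * h)
              + real (T + 1 - s) * (8 * h * noise + 6 * h * noise)"
      using selection_bias[OF _ s'] by (intro expected_suffix s x_edom s') (auto intro: order.trans[OF abs_ge_self])
    finally show ?thesis by (simp add: B_def perm_mean_const)
  qed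
  then have "y (T + 1) \<le> (\<Sum>t=1..T. y (t + 1)) / real T + B * ln (real T)"
    by (rule last_iterate_le_average[OF T B])
  also have "(\<Sum>t=1..T. y (t + 1)) / real T
      \<le> ((norm (z - x1))\<^sup>2 / (2 * h) + real T * B) / real T"
  proof (rule divide_right_mono)
    have "(\<Sum>t=1..T. y (t + 1)) \<le> perm_mean n (\<lambda>p. (norm (z - x p 1))\<^sup>2) / (2 * h)
              + real (T + 1 - 1) * (8 * h * noise + 0)"
      unfolding y_def
    proof (rule expected_suffix)
      fix a assume "a \<in> {1..n}"
      then show "perm_mean n (\<lambda>p. f (p a) z - fbar z) \<le> 0"
        using perm_mean_entry[of a n "\<lambda>i. f i z"]
        by (simp add: perm_mean_diff perm_mean_const fbar_def)
    qed (use T z in auto)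
    also have "perm_mean n (\<lambda>p. (norm (z - x p 1))\<^sup>2) = perm_mean n (\<lambda>p. (norm (z - x1))\<^sup>2)"
      by (rule perm_mean_cong) (simp add: x_first[simplified])
    also have "\<dots> = (norm (z - x1))\<^sup>2" by (rule perm_mean_const)
    also have "real (T + 1 - 1) * (8 * h * noise + 0) \<le> real T * B"
      using h noise_pos by (simp add: B_def)
    finally show "(\<Sum>t=1..T. y (t + 1)) \<le> (norm (z - x1))\<^sup>2 / (2 * h) + real T * B" by simp
  qed simp
  also have "\<dots> = (norm (z - x1))\<^sup>2 / (2 * h * real T) + B"
    using T by (simp add: add_divide_distrib)
  finally show ?thesis by (simp add: y_def B_def algebra_simps)
qed

end


section \<open>The rate of the last iterate\<close>

lemma is_arg_min_am_gm:
  fixes a b c :: real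
  assumes "a > 0" "b > 0" "c > 0"
  shows "is_arg_min (\<lambda>\<eta>. (a\<^sup>2 / \<eta> + \<eta> * b) * c) (\<lambda>\<eta>. \<eta> > 0) (a / sqrt b)"
proof -
  have opt: "a\<^sup>2 / (a / sqrt b) + a / sqrt b * b = 2 * (a * sqrt b)"
  proof -
    have "a / sqrt b * b = a * (b / sqrt b)" by simp
    also have "\<dots> = a * sqrt b" using assms by (simp add: real_div_sqrt)
    finally show ?thesis using assms by (simp add: power2_eq_square)
  qed
  have "2 * (a * sqrt b) \<le> a\<^sup>2 / \<eta> + \<eta> * b" if "\<eta> > 0" for \<eta>
  proof -
    have "0 \<le> (a - \<eta> * sqrt b)\<^sup>2 / \<eta>" using that by simp
    also have "\<dots> = a\<^sup>2 / \<eta> + \<eta> * b - 2 * (a * sqrt b)"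
      using that assms by (simp add: power2_diff power_mult_distrib field_simps power2_eq_square)
    finally show ?thesis by simp
  qed
  then show ?thesis
    unfolding is_arg_min_linorder opt using assms
    by (auto intro!: mult_right_mono)
qed

theorem theoremA4:
  shows "\<exists>C>0. \<forall>(d::nat) (n::nat) (f :: nat \<Rightarrow> fin_seq \<Rightarrow> real) (g :: nat \<Rightarrow> fin_seq \<Rightarrow> fin_seq)
      (\<psi> :: fin_seq \<Rightarrow> ereal) (G :: nat \<Rightarrow> real) (x1 :: fin_seq) (T::nat).
    composite_problem d n f g \<psi> G \<longrightarrow> x1 \<in> edom (Rd d) \<psi> \<longrightarrow> T \<ge> 1 \<longrightarrow>
      (\<forall>(\<eta>::real) (x :: (nat \<Rightarrow> nat) \<Rightarrow> nat \<Rightarrow> fin_seq). \<eta> > 0 \<longrightarrow>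
         (\<forall>p. p permutes {1..n} \<longrightarrow>
            prox_gradient_iterates d g \<psi> x1 T (\<lambda>t. \<eta> / sqrt (real T)) (ss_index n p) (x p)) \<longrightarrow>
         (\<forall>z\<in>Rd d.
            ereal_expectation (uniform_permutation n)
              (\<lambda>p. objective n f \<psi> (x p (T + 1)) - objective n f \<psi> z)
            \<le> ereal (C * ss_rate n T G x1 z \<eta>))) \<and>
      (\<forall>z\<in>Rd d. z \<noteq> x1 \<longrightarrow>
         is_arg_min (ss_rate n T G x1 z) (\<lambda>\<eta>. \<eta> > 0) (norm (z - x1) / sqrt (ss_noise n T G)))"
proof (intro exI[of _ 14] conjI allI impI ballI)
  fix d n f g \<psi> G x1 T \<eta> x z
  assume problem: "composite_problem d n f g \<psi> G" and x1: "x1 \<in> edom (Rd d) \<psi>"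
    and T: "T \<ge> 1" and \<eta>: "\<eta> > 0"
    and iterates: "\<forall>p. p permutes {1..n} \<longrightarrow>
      prox_gradient_iterates d g \<psi> x1 T (\<lambda>t. \<eta> / sqrt (real T)) (ss_index n p) (x p)"
    and z: "z \<in> Rd d"
  interpret single_shuffle d n f g \<psi> G T x1 "\<eta> / sqrt (real T)" x
    using problem x1 T \<eta> iterates by unfold_locales auto
  have obj: "objective n f \<psi> w = ereal (Fbar w)" if "w \<in> edom (Rd d) \<psi>" for w
    using edom_realE[OF pcc that] by (simp add: objective_def Fbar_def fbar_def flip: plus_ereal.simps(1))
  have last: "x p (T + 1) \<in> edom (Rd d) \<psi>" if "p permutes {1..n}" for p
    using x_edom[OF that] by simp
  show "ereal_expectation (uniform_permutation n)
          (\<lambda>p. objective n f \<psi> (x p (T + 1)) - objective n f \<psi> z)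
        \<le> ereal (14 * ss_rate n T G x1 z \<eta>)"
  proof (cases "z \<in> edom (Rd d) \<psi>")
    case False
    then have "objective n f \<psi> z = \<infinity>" using z by (auto simp: edom_def objective_def)
    then show ?thesis using obj last by (subst ereal_expectation_perm_MInf) auto
  next
    case True
    have "ereal_expectation (uniform_permutation n)
          (\<lambda>p. objective n f \<psi> (x p (T + 1)) - objective n f \<psi> z)
        = ereal (perm_mean n (\<lambda>p. Fbar (x p (T + 1)) - Fbar z))"
      by (rule ereal_expectation_perm) (simp add: obj last[simplified] True)
    also have "\<dots> \<le> ereal (14 * ss_rate n T G x1 z \<eta>)"
    proof -
      have sT: "sqrt (real T) > 0" "real T = sqrt (real T) * sqrt (real T)" using T by auto
      have "(norm (z - x1))\<^sup>2 / (2 * (\<eta> / sqrt (real T)) * real T)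
          = (1 / 2) * ((norm (z - x1))\<^sup>2 / \<eta> * (1 / sqrt (real T)))"
        using sT \<eta> by (subst sT(2)) (simp add: field_simps)
      also have "\<dots> \<le> 14 * ((norm (z - x1))\<^sup>2 / \<eta> * (1 / sqrt (real T)))"
        using \<eta> by (intro mult_right_mono) auto
      finally have "perm_mean n (\<lambda>p. Fbar (x p (T + 1)) - Fbar z)
          \<le> 14 * ((norm (z - x1))\<^sup>2 / \<eta> * (1 / sqrt (real T)))
            + 14 * (\<eta> / sqrt (real T)) * noise * (1 + ln (real T))"
        using last_iterate_bound[OF True] by linarith
      also have "\<dots> = 14 * ss_rate n T G x1 z \<eta>"
        unfolding ss_rate_def ss_noise_def noise_def[symmetric]
        by (simp add: distrib_left distrib_right add_divide_distrib)
      finally show ?thesis by simp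
    qed
    finally show ?thesis .
  qed
next
  fix d n f g \<psi> G and T :: nat and x1 z :: fin_seq
  assume problem: "composite_problem d n f g \<psi> G" and T: "T \<ge> 1" and z: "z \<noteq> x1"
  interpret composite d n f g \<psi> G T
    using problem T by unfold_locales
  have "ss_noise n T G > 0"
    unfolding ss_noise_def noise_def[symmetric]
    using noise_pos T by (intro mult_pos_pos add_pos_nonneg) auto
  moreover have "ss_rate n T G x1 z
      = (\<lambda>\<eta>. ((norm (z - x1))\<^sup>2 / \<eta> + \<eta> * ss_noise n T G) * (1 / sqrt (real T)))"
    by (rule ext) (simp add: ss_rate_def)
  ultimately show "is_arg_min (ss_rate n T G x1 z) (\<lambda>\<eta>. \<eta> > 0) (norm (z - x1) / sqrt (ss_noise n T G))"
    using is_arg_min_am_gm[of "norm (z - x1)" "ss_noise n T G" "1 / sqrt (real T)"] z T by simp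
qed simp

end
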